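(* Let $p$ be a prime and let $W$ be a residually algebraic torsion extension of $\mathbb{Z}_p$ to $\mathbb{Q}_p(X)$. Then the completion $\widehat{\mathbb{Q}_p(X)}$ of $\mathbb{Q}_p(X)$ with respect to $W$ is (isomorphic to) a subfield of $\mathbb{C}_p$ if and only if there exists an element $\alpha\in\mathbb{C}_p$, transcendental over $\mathbb{Q}_p$, such that $W=\mathbb{Z}_{p,\alpha}$.
   Context: $\overline{\mathbb{Q}_p}$ is a fixed algebraic closure of $\mathbb{Q}_p$, $\mathbb{C}_p$ is its completion with respect to the unique extension of the $p$-adic valuation $v_p$, and $\mathbb{O}_p$ is the valuation ring of the unique extension of $v_p$ to $\mathbb{C}_p$. A valuation domain $W$ of $\mathbb{Q}_p(X)$ (i.e. with quotient field $\mathbb{Q}_p(X)$) is an extension of $\mathbb{Z}_p$ if $W\cap\mathbb{Q}_p=\mathbb{Z}_p$; it is residually algebraic if its residue field is algebraic over $\mathbb{F}_p$, and torsion if its value group is contained in the divisible hull $\mathbb{Q}$ of the value group $\mathbb{Z}$ of $v_p$. For $\alpha\in\mathbb{C}_p$, $\mathbb{Z}_{p,\alpha}=\{\phi\in\mathbb{Q}_p(X)\mid\phi(\alpha)\in\mathbb{O}_p\}$. *)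

theory Defs
  imports
    "HOL-Algebra.Algebraic_Closure_Type"
    "HOL-Library.Extended_Real"
begin

text \<open>
  The fields \<open>\<rat>\<^sub>p\<close>, its algebraic closure, \<open>\<complex>\<^sub>p\<close> and the completion of
  \<open>\<rat>\<^sub>p(X)\<close> are not fixed constructions here: each is a type of class \<open>field\<close> with
  a valuation and an embedding of the previous field, subject to the property that defines
  it up to isomorphism.  The field \<open>\<rat>\<^sub>p(X)\<close> is the type \<open>'q poly fract\<close>.
\<close>

abbreviation type_ring :: "'a::field ring" where
  "type_ring \<equiv> ring_of_type_algebra"


text \<open>Real-valued (rank at most one) valuations, written additively.\<close>

definition is_valuation :: "('a::field \<Rightarrow> ereal) \<Rightarrow> bool" where
  "is_valuation v \<longleftrightarrow>
     (\<forall>x. v x \<noteq> -\<infinity>) \<and>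
     (\<forall>x. v x = \<infinity> \<longleftrightarrow> x = 0) \<and>
     (\<forall>x y. v (x * y) = v x + v y) \<and>
     (\<forall>x y. v (x + y) \<ge> min (v x) (v y))"

definition valuation_ring_of :: "('a::field \<Rightarrow> ereal) \<Rightarrow> 'a set" where
  "valuation_ring_of v = {x. v x \<ge> 0}"

definition padic_valuation :: "nat \<Rightarrow> rat \<Rightarrow> ereal" where
  "padic_valuation p x =
     (if x = 0 then \<infinity>
      else ereal (real (multiplicity (int p) (fst (quotient_of x)))
                - real (multiplicity (int p) (snd (quotient_of x)))))"

definition val_Cauchy :: "('a::field \<Rightarrow> ereal) \<Rightarrow> (nat \<Rightarrow> 'a) \<Rightarrow> bool" where
  "val_Cauchy v s \<longleftrightarrow> (\<forall>r::real. \<exists>N. \<forall>m\<ge>N. \<forall>n\<ge>N. v (s m - s n) > ereal r)"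

definition val_tendsto :: "('a::field \<Rightarrow> ereal) \<Rightarrow> (nat \<Rightarrow> 'a) \<Rightarrow> 'a \<Rightarrow> bool" where
  "val_tendsto v s l \<longleftrightarrow> (\<forall>r::real. \<exists>N. \<forall>n\<ge>N. v (s n - l) > ereal r)"

definition val_complete :: "('a::field \<Rightarrow> ereal) \<Rightarrow> bool" where
  "val_complete v \<longleftrightarrow> (\<forall>s. val_Cauchy v s \<longrightarrow> (\<exists>l. val_tendsto v s l))"

definition extends_along ::
    "('a::field \<Rightarrow> 'b::field) \<Rightarrow> ('a \<Rightarrow> ereal) \<Rightarrow> ('b \<Rightarrow> ereal) \<Rightarrow> bool" where
  "extends_along h v w \<longleftrightarrow>
     h \<in> ring_hom type_ring type_ring \<and> is_valuation w \<and> (\<forall>x. w (h x) = v x)"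

definition is_completion ::
    "('a::field \<Rightarrow> ereal) \<Rightarrow> ('b::field \<Rightarrow> ereal) \<Rightarrow> ('a \<Rightarrow> 'b) \<Rightarrow> bool" where
  "is_completion v w h \<longleftrightarrow>
     extends_along h v w \<and>
     (\<forall>y. \<exists>s. val_tendsto w (\<lambda>n. h (s n)) y) \<and>
     val_complete w"


definition const_fract :: "'q::field \<Rightarrow> 'q poly fract" where
  "const_fract c = to_fract [:c:]"

text \<open>The last condition says that \<open>W\<close> has the whole field as its field of fractions.\<close>

definition is_valuation_domain :: "'a::field set \<Rightarrow> bool" where
  "is_valuation_domain W \<longleftrightarrow>
     subdomain W type_ring \<and> (\<forall>x. x \<noteq> 0 \<longrightarrow> x \<in> W \<or> inverse x \<in> W)"

definition maximal_ideal_of :: "'a::field set \<Rightarrow> 'a set" where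
  "maximal_ideal_of W = {x \<in> W. x = 0 \<or> inverse x \<notin> W}"

definition residue_field :: "'a::field set \<Rightarrow> 'a set ring" where
  "residue_field W = (type_ring\<lparr>carrier := W\<rparr>) Quot (maximal_ideal_of W)"

definition residue_class :: "'a::field set \<Rightarrow> 'a \<Rightarrow> 'a set" where
  "residue_class W x = maximal_ideal_of W +>\<^bsub>type_ring\<lparr>carrier := W\<rparr>\<^esub> x"

text \<open>
  In the remaining definitions \<open>v\<close> is the \<open>p\<close>-adic valuation on \<open>\<rat>\<^sub>p\<close>, so that
  \<open>valuation_ring_of v\<close> is \<open>\<int>\<^sub>p\<close>, and the residue classes of its elements form the copy
  of \<open>\<bbbF>\<^sub>p\<close> in the residue field of \<open>W\<close>.
\<close>

definition is_extension_to_fract ::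
    "('q::field \<Rightarrow> ereal) \<Rightarrow> 'q poly fract set \<Rightarrow> bool" where
  "is_extension_to_fract v W \<longleftrightarrow>
     is_valuation_domain W \<and> {c. const_fract c \<in> W} = valuation_ring_of v"

definition residually_algebraic ::
    "('q::field \<Rightarrow> ereal) \<Rightarrow> 'q poly fract set \<Rightarrow> bool" where
  "residually_algebraic v W \<longleftrightarrow>
     (\<forall>y \<in> carrier (residue_field W).
        \<not> ring.transcendental (residue_field W)
            ((\<lambda>c. residue_class W (const_fract c)) ` valuation_ring_of v) y)"

text \<open>
  The valuation with valuation ring \<open>W\<close>, normalised so as to extend \<open>v\<close>.  For an
  extension \<open>W\<close> of rank one there is exactly one.
\<close>

definition is_valuation_for ::
    "('q::field \<Rightarrow> ereal) \<Rightarrow> 'q poly fract set \<Rightarrow> ('q poly fract \<Rightarrow> ereal) \<Rightarrow> bool" where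
  "is_valuation_for v W w \<longleftrightarrow>
     extends_along const_fract v w \<and> valuation_ring_of w = W"

text \<open>
  The value group of \<open>v\<close> being \<open>\<int> \<subseteq> \<real>\<close>, its divisible hull is \<open>\<rat> \<subseteq> \<real>\<close>.
\<close>

definition is_torsion :: "('q::field \<Rightarrow> ereal) \<Rightarrow> 'q poly fract set \<Rightarrow> bool" where
  "is_torsion v W \<longleftrightarrow>
     (\<exists>w. is_valuation_for v W w \<and> w ` (UNIV - {0}) \<subseteq> ereal ` \<rat>)"

text \<open>
  The ring of all \<open>\<phi> \<in> \<rat>\<^sub>p(X)\<close> that are defined at \<open>\<alpha>\<close> with \<open>\<phi>(\<alpha>)\<close> integral;
  \<open>e\<close> is the embedding of \<open>\<rat>\<^sub>p\<close> into \<open>\<complex>\<^sub>p\<close>.  The value \<open>\<phi>(\<alpha>)\<close> does not depend on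
  the chosen representation \<open>f / g\<close> with \<open>g(\<alpha>) \<noteq> 0\<close>.
\<close>

definition integral_at ::
    "('q::field \<Rightarrow> 'c::field) \<Rightarrow> ('c \<Rightarrow> ereal) \<Rightarrow> 'c \<Rightarrow> 'q poly fract set" where
  "integral_at e vC \<alpha> =
     {to_fract f / to_fract g | f g.
        poly (map_poly e g) \<alpha> \<noteq> 0 \<and>
        poly (map_poly e f) \<alpha> / poly (map_poly e g) \<alpha> \<in> valuation_ring_of vC}"

text \<open>
  Isomorphic as a valued field: the topology matters, since \<open>\<complex>\<^sub>p\<close> and the completion
  are being compared as completions, and every field of characteristic zero and of
  cardinality at most that of the continuum is abstractly isomorphic to a subfield of
  \<open>\<complex>\<^sub>p\<close>.  Such an isomorphism automatically fixes \<open>\<rat>\<^sub>p\<close>, the closure of \<open>\<rat>\<close>.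
\<close>

definition iso_to_valued_subfield ::
    "('l::field \<Rightarrow> ereal) \<Rightarrow> ('c::field \<Rightarrow> ereal) \<Rightarrow> bool" where
  "iso_to_valued_subfield wL vC \<longleftrightarrow>
     (\<exists>S f. subfield S type_ring \<and>
            f \<in> ring_iso type_ring (type_ring\<lparr>carrier := S\<rparr>) \<and>
            (\<forall>x. vC (f x) = wL x))"

end

theory Submission
  imports Defs
begin

text \<open>
  An isometric embedding of the completion into \<open>\<complex>\<^sub>p\<close> restricts to the given embedding on
  \<open>\<rat>\<^sub>p\<close>, because the two agree on \<open>\<rat>\<close>, which is dense; on \<open>\<rat>\<^sub>p(X)\<close> it is therefore
  evaluation at the image \<open>\<alpha>\<close> of \<open>X\<close>, and \<open>\<alpha>\<close> is transcendental because evaluation is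
  injective.  Conversely, evaluation at a transcendental \<open>\<alpha>\<close> pulls the valuation of
  \<open>\<complex>\<^sub>p\<close> back to a valuation with ring \<open>W\<close>, which must be the normalised one; the
  evaluation is thus isometric and extends to the completion by continuity.
\<close>

section \<open>Field embeddings: action on polynomials, ranges and fraction fields\<close>

locale field_embedding =
  fixes h :: "'a::field \<Rightarrow> 'b::field"
  assumes add: "h (x + y) = h x + h y"
    and mult: "h (x * y) = h x * h y"
    and one: "h 1 = 1"
begin

lemma zero: "h 0 = 0"
  by (metis add add_cancel_right_right)

lemma diff: "h (x - y) = h x - h y"
  using add[of "x - y" y] by (simp add: algebra_simps)

lemma eq_0_iff: "h x = 0 \<longleftrightarrow> x = 0"
  using mult[of x "inverse x"] zero one by (cases "x = 0") auto

lemma eq_iff: "h x = h y \<longleftrightarrow> x = y"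
  using diff[of x y] eq_0_iff[of "x - y"] by simp

lemma divide: "h (x / y) = h x / h y"
proof (cases "y = 0")
  case False
  then show ?thesis
    using mult[of "x / y" y] by (simp add: eq_0_iff field_simps)
qed (simp add: zero)

lemma of_nat: "h (of_nat n) = of_nat n"
  by (induction n) (simp_all add: zero one add)

lemma of_int: "h (of_int n) = of_int n"
proof (cases n)
  case (neg m)
  then show ?thesis
    using diff[of 0 "of_nat (Suc m)"] by (simp only: of_int_minus of_int_of_nat_eq of_nat zero diff_0)
qed (simp add: of_nat)

lemma map_poly_add: "map_poly h (f + g) = map_poly h f + map_poly h g"
  by (rule poly_eqI) (simp add: coeff_map_poly zero add)

lemma poly_pCons: "poly (map_poly h (pCons a f)) x = h a + x * poly (map_poly h f) x"
  by (simp add: map_poly_pCons zero)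

lemma poly_add:
  "poly (map_poly h (f + g)) x = poly (map_poly h f) x + poly (map_poly h g) x"
  by (simp add: map_poly_add)

lemma poly_mult:
  "poly (map_poly h (f * g)) x = poly (map_poly h f) x * poly (map_poly h g) x"
proof (induction f)
  case (pCons a f)
  have "poly (map_poly h (smult a g)) x = h a * poly (map_poly h g) x"
    by (simp add: map_poly_smult zero mult)
  then show ?case
    by (simp add: mult_pCons_left poly_add poly_pCons zero pCons.IH algebra_simps)
qed simp

end

text \<open>The carrier of \<open>type_ring\<close> is the whole type, so the membership conditions
  in \<open>ring_hom\<close> vanish and three plain equations remain.\<close>

lemma ring_hom_type_ring_iff:
  "h \<in> ring_hom type_ring type_ring \<longleftrightarrow> field_embedding h"
  by (auto simp: ring_hom_def ring_of_type_algebra_def field_embedding_def)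

lemma extends_along_iff:
  "extends_along h v w \<longleftrightarrow> field_embedding h \<and> is_valuation w \<and> (\<forall>x. w (h x) = v x)"
  by (simp add: extends_along_def ring_hom_type_ring_iff)

lemma field_embedding_comp:
  assumes "field_embedding g" "field_embedding h"
  shows "field_embedding (g \<circ> h)"
  using assms by (simp add: field_embedding_def)

text \<open>An embedding is forced on the integers by its value at 1, hence on their quotients. This
  supplies the agreement on the dense subfield when two embeddings of the p-adic numbers are
  compared.\<close>

lemma field_embedding_rat_unique:
  fixes g h :: "rat \<Rightarrow> 'a::field"
  assumes "field_embedding g" "field_embedding h"
  shows "g = h"
proof
  fix x :: rat
  obtain a b where "quotient_of x = (a, b)" by (cases "quotient_of x")
  then have x: "x = of_int a / of_int b" by (rule quotient_of_div)
  show "g x = h x"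
    by (simp add: x field_embedding.divide[OF assms(1)] field_embedding.divide[OF assms(2)]
        field_embedding.of_int[OF assms(1)] field_embedding.of_int[OF assms(2)])
qed

lemma subfield_range:
  fixes h :: "'a::field \<Rightarrow> 'b::field"
  assumes "field_embedding h"
  shows "subfield (range h) type_ring"
proof -
  have c: "carrier (type_ring :: 'a ring) = UNIV"
    by (simp add: ring_of_type_algebra_def)
  interpret R: field "type_ring :: 'a ring" by (rule field_from_type_algebra)
  interpret S: field "type_ring :: 'b ring" by (rule field_from_type_algebra)
  interpret ring_hom_ring "type_ring :: 'a ring" "type_ring :: 'b ring" h
    using assms by unfold_locales (simp add: ring_hom_type_ring_iff)
  show ?thesis
    using img_is_subfield(2)[OF R.carrier_is_subfield] by (simp add: c)
qed

text \<open>An embedding of fields is injective and its range is a subfield, so the subfield in the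
  definition carries no information beyond the map itself.\<close>

lemma iso_to_valued_subfield_iff:
  "iso_to_valued_subfield wL vC \<longleftrightarrow> (\<exists>f. field_embedding f \<and> (\<forall>x. vC (f x) = wL x))"
  (is "?L \<longleftrightarrow> ?R")
proof
  assume ?L
  then show ?R
    by (auto simp: iso_to_valued_subfield_def ring_iso_def ring_hom_def
        ring_of_type_algebra_def field_embedding_def)
next
  assume ?R
  then obtain f where f: "field_embedding f" "\<forall>x. vC (f x) = wL x" by blast
  have "inj f"
    by (simp add: inj_def field_embedding.eq_iff[OF f(1)])
  then have "f \<in> ring_iso type_ring (type_ring\<lparr>carrier := range f\<rparr>)"
    using f(1) by (auto simp: ring_iso_def ring_hom_def ring_of_type_algebra_def
        field_embedding_def bij_betw_def)
  with f subfield_range[OF f(1)] show ?L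
    unfolding iso_to_valued_subfield_def by blast
qed

text \<open>A trivial kernel keeps the images of denominators nonzero, so quotients can be mapped to
  quotients. This turns evaluation at a transcendental element into an embedding of the rational
  function field.\<close>

lemma extend_to_fract:
  fixes P :: "'a::idom \<Rightarrow> 'b::field"
  assumes add: "\<And>x y. P (x + y) = P x + P y"
    and mult: "\<And>x y. P (x * y) = P x * P y"
    and one: "P 1 = 1"
    and inj: "\<And>x. P x = 0 \<Longrightarrow> x = 0"
  obtains ev where "field_embedding ev" "\<And>x. ev (to_fract x) = P x"
proof -
  have nz: "P x \<noteq> 0" if "x \<noteq> 0" for x
    using inj that by blast
  have "\<exists>n d. d \<noteq> 0 \<and> x = Fract n d" for x :: "'a fract"
    by (cases x) auto
  then obtain N D where ND: "\<And>x :: 'a fract. D x \<noteq> 0" "\<And>x. x = Fract (N x) (D x)"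
    by metis
  define ev where "ev x = P (N x) / P (D x)" for x
  \<comment> \<open>\<open>N\<close> and \<open>D\<close> choose an arbitrary representation.
    Cross-multiplication shows that the choice does not affect the value, after which any
    representation may be used.\<close>
  have ev: "ev (Fract a b) = P a / P b" if "b \<noteq> 0" for a b
  proof -
    have "a * D (Fract a b) = N (Fract a b) * b"
      using ND(2)[of "Fract a b"] ND(1) that by (simp add: eq_fract)
    then have "P a * P (D (Fract a b)) = P (N (Fract a b)) * P b"
      by (metis mult)
    then show ?thesis
      using nz[OF that] nz[OF ND(1)] by (simp add: ev_def frac_eq_eq)
  qed
  show thesis
  proof
    show "ev (to_fract x) = P x" for x
      by (simp add: to_fract_def ev one)
    show "field_embedding ev"
    proof
      fix x y :: "'a fract"
      obtain a b where x: "x = Fract a b" "b \<noteq> 0" by (cases x) auto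
      obtain c d where y: "y = Fract c d" "d \<noteq> 0" by (cases y) auto
      show "ev (x + y) = ev x + ev y"
        using x y nz by (simp add: ev add mult add_frac_eq)
      show "ev (x * y) = ev x * ev y"
        using x y by (simp add: ev mult)
    qed (simp add: One_fract_def ev one)
  qed
qed

section \<open>Real-valued valuations: arithmetic, limits, and recovery from the valuation
  ring\<close>

locale valuation =
  fixes v :: "'a::field \<Rightarrow> ereal"
  assumes is_valuation: "is_valuation v"
begin

lemma not_MInf: "v x \<noteq> -\<infinity>"
  and eq_PInf_iff: "v x = \<infinity> \<longleftrightarrow> x = 0"
  and mult: "v (x * y) = v x + v y"
  and add_ge: "min (v x) (v y) \<le> v (x + y)"
  using is_valuation by (auto simp: is_valuation_def)

lemma zero: "v 0 = \<infinity>"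
  by (simp add: eq_PInf_iff)

lemma realE:
  assumes "x \<noteq> 0"
  obtains r where "v x = ereal r"
  using not_MInf[of x] eq_PInf_iff[of x] assms by (cases "v x") auto

lemma one: "v 1 = 0"
proof -
  obtain r where "v 1 = ereal r" using realE[of 1] by auto
  with mult[of 1 1] show ?thesis by simp
qed

lemma minus: "v (- x) = v x"
proof -
  obtain r where r: "v (- 1) = ereal r" using realE[of "- 1"] by auto
  \<comment> \<open>Twice this value is \<open>v 1\<close>, which is 0, and the value is
    finite.\<close>
  with mult[of "- 1" "- 1"] have "v (- 1) = 0" by (simp add: one)
  with mult[of "- 1" x] show ?thesis by simp
qed

lemma less_add: "c < v x \<Longrightarrow> c < v y \<Longrightarrow> c < v (x + y)"
  using add_ge[of x y] by (auto simp: min_def split: if_splits)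

lemma less_diff: "c < v x \<Longrightarrow> c < v y \<Longrightarrow> c < v (x - y)"
  using less_add[of c x "- y"] by (simp add: minus)

text \<open>If \<open>v (x + y)\<close> were larger than \<open>v x\<close>, then x, as the
  difference of \<open>x + y\<close> and y, would have a value larger than its own.\<close>

lemma add_eq:
  assumes "v x < v y"
  shows "v (x + y) = v x"
proof (rule antisym)
  show "v x \<le> v (x + y)"
    using add_ge[of x y] assms by (simp add: min_def split: if_splits)
  show "v (x + y) \<le> v x"
    using less_diff[of "v x" "x + y" y] assms by force
qed

lemma power: "v x = ereal r \<Longrightarrow> v (x ^ n) = ereal (real n * r)"
  by (induction n) (simp_all add: one mult algebra_simps)

lemma inverse:
  assumes "v x = ereal r"
  shows "v (inverse x) = ereal (- r)"
proof -
  have "x \<noteq> 0" using assms eq_PInf_iff[of x] by auto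
  then obtain s where s: "v (inverse x) = ereal s" using realE[of "inverse x"] by auto
  from mult[of x "inverse x"] \<open>x \<noteq> 0\<close> assms s show ?thesis by (simp add: one)
qed

lemma power_int:
  assumes "v x = ereal r"
  shows "v (x powi n) = ereal (of_int n * r)"
proof (cases "n \<ge> 0")
  case True
  then show ?thesis using power[OF assms, of "nat n"] by (simp add: power_int_def)
next
  case False
  then show ?thesis
    using power[OF inverse[OF assms], of "nat (- n)"] by (simp add: power_int_def)
qed

lemma tendsto_iff:
  "val_tendsto v s l \<longleftrightarrow> (\<forall>r::real. \<forall>\<^sub>F n in sequentially. ereal r < v (s n - l))"
  by (simp add: val_tendsto_def eventually_sequentially)

lemma tendsto_const: "val_tendsto v (\<lambda>_. l) l"
  by (simp add: val_tendsto_def zero)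

lemma tendsto_add:
  assumes "val_tendsto v s l" "val_tendsto v t m"
  shows "val_tendsto v (\<lambda>n. s n + t n) (l + m)"
  unfolding tendsto_iff
proof
  fix r :: real
  have "\<forall>\<^sub>F n in sequentially. ereal r < v (s n - l) \<and> ereal r < v (t n - m)"
    using assms by (simp add: tendsto_iff eventually_conj_iff)
  then show "\<forall>\<^sub>F n in sequentially. ereal r < v (s n + t n - (l + m))"
    by eventually_elim (metis less_add add_diff_add)
qed

lemma tendsto_diff:
  assumes "val_tendsto v s l" "val_tendsto v t m"
  shows "val_tendsto v (\<lambda>n. s n - t n) (l - m)"
  unfolding tendsto_iff
proof
  fix r :: real
  have "\<forall>\<^sub>F n in sequentially. ereal r < v (s n - l) \<and> ereal r < v (t n - m)"
    using assms by (simp add: tendsto_iff eventually_conj_iff)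
  then show "\<forall>\<^sub>F n in sequentially. ereal r < v (s n - t n - (l - m))"
  proof eventually_elim
    case (elim n)
    then have "ereal r < v ((s n - l) - (t n - m))" by (simp add: less_diff)
    then show ?case by (simp add: algebra_simps)
  qed
qed

lemma tendsto_mult_const:
  assumes "val_tendsto v s 0"
  shows "val_tendsto v (\<lambda>n. s n * c) 0"
proof (cases "c = 0")
  case True
  then show ?thesis by (simp add: tendsto_const)
next
  case False
  then obtain a where a: "v c = ereal a" by (rule realE)
  show ?thesis
    unfolding tendsto_iff
  proof
    fix r :: real
    have "\<forall>\<^sub>F n in sequentially. ereal (r - a) < v (s n)"
      using assms by (simp add: tendsto_iff)
    then show "\<forall>\<^sub>F n in sequentially. ereal r < v (s n * c - 0)"
    proof eventually_elim
      case (elim n)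
      then show ?case by (cases "v (s n)") (auto simp: mult a)
    qed
  qed
qed

lemma tendsto_mult_null:
  assumes "val_tendsto v s 0" "val_tendsto v t 0"
  shows "val_tendsto v (\<lambda>n. s n * t n) 0"
  unfolding tendsto_iff
proof
  fix r :: real
  \<comment> \<open>One factor alone reaches the bound r; the other only has to have positive
    value.\<close>
  have "\<forall>\<^sub>F n in sequentially. ereal r < v (s n) \<and> ereal 0 < v (t n)"
    using assms by (simp add: tendsto_iff eventually_conj_iff del: ereal_less)
  then show "\<forall>\<^sub>F n in sequentially. ereal r < v (s n * t n - 0)"
  proof eventually_elim
    case (elim n)
    then show ?case by (cases "v (s n)"; cases "v (t n)") (auto simp: mult)
  qed
qed

lemma tendsto_mult:
  assumes "val_tendsto v s l" "val_tendsto v t m"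
  shows "val_tendsto v (\<lambda>n. s n * t n) (l * m)"
proof -
  have s: "val_tendsto v (\<lambda>n. s n - l) 0" and t: "val_tendsto v (\<lambda>n. t n - m) 0"
    using assms by (simp_all add: tendsto_iff)
  \<comment> \<open>The error of the product is expanded around the two limits, so that every
    summand contains a null factor.\<close>
  have "val_tendsto v (\<lambda>n. (s n - l) * (t n - m) + (s n - l) * m + (t n - m) * l) (0 + 0 + 0)"
    by (intro tendsto_add tendsto_mult_null tendsto_mult_const s t)
  moreover have "(s n - l) * (t n - m) + (s n - l) * m + (t n - m) * l = s n * t n - l * m" for n
    by (simp add: algebra_simps)
  ultimately show ?thesis by (simp add: tendsto_iff)
qed

text \<open>Once \<open>s n - l\<close> has larger value than l, \<open>add_eq\<close> applies to
  the sum of l and \<open>s n - l\<close>. Values therefore become constant along the sequence,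
  which makes an isometry survive passage to the limit.\<close>

lemma eventually_val_eq:
  assumes "val_tendsto v s l" "l \<noteq> 0"
  shows "\<forall>\<^sub>F n in sequentially. v (s n) = v l"
proof -
  obtain r where r: "v l = ereal r" using assms(2) by (rule realE)
  have "\<forall>\<^sub>F n in sequentially. ereal r < v (s n - l)"
    using assms(1) by (simp add: tendsto_iff)
  then show ?thesis
    by eventually_elim (use add_eq[of l] r in fastforce)
qed

lemma tendsto_unique:
  assumes "val_tendsto v s l" "val_tendsto v s m"
  shows "l = m"
proof (rule ccontr)
  assume "l \<noteq> m"
  \<comment> \<open>The zero sequence would converge to a nonzero element, whose finite value would
    then equal the infinite value of 0.\<close>
  have "val_tendsto v (\<lambda>_. 0) (l - m)"
    using tendsto_diff[OF assms] by simp
  from eventually_val_eq[OF this] \<open>l \<noteq> m\<close> have "v 0 = v (l - m)" by simp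
  with \<open>l \<noteq> m\<close> show False using eq_PInf_iff[of "l - m"] zero by simp
qed

lemma tendsto_imp_Cauchy:
  assumes "val_tendsto v s l"
  shows "val_Cauchy v s"
  unfolding val_Cauchy_def
proof
  fix r :: real
  obtain N where N: "\<And>n. n \<ge> N \<Longrightarrow> ereal r < v (s n - l)"
    using assms unfolding val_tendsto_def by blast
  have "ereal r < v (s m - s n)" if "m \<ge> N" "n \<ge> N" for m n
    using less_diff[OF N[OF that(1)] N[OF that(2)]] by simp
  then show "\<exists>N. \<forall>m\<ge>N. \<forall>n\<ge>N. ereal r < v (s m - s n)" by blast
qed

text \<open>A real-valued valuation, normalised at \<open>\<pi>\<close>, is recovered from its ring because
  \<open>n v(x) \<ge> m v(\<pi>)\<close> holds iff \<open>x\<^sup>n / \<pi>\<^sup>m\<close> is integral.\<close>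

lemma le_if_valuation_ring_le:
  assumes v': "is_valuation v'"
    and ring: "valuation_ring_of v \<subseteq> valuation_ring_of v'"
    and \<pi>: "v \<pi> = v' \<pi>" "0 < v \<pi>" "\<pi> \<noteq> 0"
  shows "v x \<le> v' x"
proof (cases "x = 0")
  case True
  then show ?thesis
    using valuation.zero[of v'] v' by (simp add: valuation_def)
next
  case False
  interpret v': valuation v' using v' by unfold_locales
  obtain r where r: "v x = ereal r" using False by (rule realE)
  obtain r' where r': "v' x = ereal r'" using False by (rule v'.realE)
  obtain c where c: "v \<pi> = ereal c" using \<pi>(3) by (rule realE)
  then have c': "v' \<pi> = ereal c" and "c > 0" using \<pi> by simp_all
  show ?thesis
  proof (rule ccontr)
    assume "\<not> v x \<le> v' x"
    then have "r' / c < r / c" using r r' \<open>c > 0\<close> by (simp add: divide_strict_right_mono)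
    \<comment> \<open>Strictness on both sides of q makes the value of \<open>?y\<close> positive
      under \<open>v\<close> and negative under \<open>v'\<close>.\<close>
    then obtain q where q: "r' / c < of_rat q" "of_rat q < r / c"
      using of_rat_dense by blast
    obtain m n where mn: "q = of_int m / of_int n" "n > 0"
      by (metis quotient_of_div quotient_of_denom_pos surj_pair)
    have ineq: "of_int n * r' < of_int m * c" "of_int m * c < of_int n * r"
      using q mn \<open>c > 0\<close> by (simp_all add: of_rat_divide field_simps)
    let ?y = "x powi n * \<pi> powi (- m)"
    have "v ?y = ereal (of_int n * r - of_int m * c)"
      using r c by (simp add: mult power_int)
    then have "?y \<in> valuation_ring_of v"
      using ineq by (simp add: valuation_ring_of_def)
    moreover have "v' ?y = ereal (of_int n * r' - of_int m * c)"
      using r' c' by (simp add: v'.mult v'.power_int)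
    then have "?y \<notin> valuation_ring_of v'"
      using ineq by (simp add: valuation_ring_of_def)
    ultimately show False
      using ring by blast
  qed
qed

end

text \<open>The ring determines a real-valued valuation only up to a positive factor; agreement at
  an element of finite positive value fixes that factor.\<close>

lemma valuation_eqI:
  assumes "is_valuation v" "is_valuation v'" "valuation_ring_of v = valuation_ring_of v'"
    and "v \<pi> = v' \<pi>" "0 < v \<pi>" "\<pi> \<noteq> 0"
  shows "v = v'"
proof
  fix x
  have "v x \<le> v' x" "v' x \<le> v x"
    using assms by (auto intro: valuation.le_if_valuation_ring_le[of _ _ \<pi>] simp: valuation_def)
  then show "v x = v' x" by simp
qed

section \<open>Isometric embeddings and the universal property of completions\<close>

lemma is_valuation_pullback:
  assumes "field_embedding h" "is_valuation w"
  shows "is_valuation (\<lambda>x. w (h x))"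
proof -
  interpret h: field_embedding h by fact
  show ?thesis
    using assms(2) by (simp add: is_valuation_def h.add h.mult h.eq_0_iff)
qed

lemma tendsto_embedding_iff:
  assumes "extends_along h v w"
  shows "val_tendsto w (\<lambda>n. h (s n)) (h l) \<longleftrightarrow> val_tendsto v s l"
proof -
  interpret h: field_embedding h using assms by (simp add: extends_along_iff)
  show ?thesis
    using assms by (simp add: val_tendsto_def extends_along_iff flip: h.diff)
qed

lemma Cauchy_embedding_iff:
  assumes "extends_along h v w"
  shows "val_Cauchy w (\<lambda>n. h (s n)) \<longleftrightarrow> val_Cauchy v s"
proof -
  interpret h: field_embedding h using assms by (simp add: extends_along_iff)
  show ?thesis
    using assms by (simp add: val_Cauchy_def extends_along_iff flip: h.diff)
qed

lemma extends_along_comp: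
  assumes "extends_along h v w" "extends_along g w u"
  shows "extends_along (g \<circ> h) v u"
  using assms by (simp add: extends_along_iff field_embedding_comp)

text \<open>Both maps preserve limits and agree on the dense image of \<open>h\<close>, and limits
  under \<open>u\<close> are unique.\<close>

lemma completion_embedding_unique:
  assumes compl: "is_completion v w h"
    and f: "extends_along f w u" and g: "extends_along g w u"
    and eq: "f \<circ> h = g \<circ> h"
  shows "f = g"
proof
  fix y
  interpret u: valuation u using f by unfold_locales (simp add: extends_along_iff)
  obtain s where s: "val_tendsto w (\<lambda>n. h (s n)) y"
    using compl unfolding is_completion_def by blast
  have "val_tendsto u (\<lambda>n. f (h (s n))) (f y)"
    using s tendsto_embedding_iff[OF f, of "\<lambda>n. h (s n)"] by simp
  moreover have "val_tendsto u (\<lambda>n. f (h (s n))) (g y)"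
    using s tendsto_embedding_iff[OF g, of "\<lambda>n. h (s n)"] fun_cong[OF eq] by simp
  ultimately show "f y = g y" by (rule u.tendsto_unique)
qed

text \<open>A sequence from the base field approximating y is Cauchy for \<open>v\<close>, so its
  image under \<open>g\<close> is Cauchy and has a limit in the complete target. That limit is taken
  as the image of y.\<close>

lemma completion_extend:
  assumes compl: "is_completion v w h"
    and g: "extends_along g v u" and u: "val_complete u"
  obtains f where "extends_along f w u" "\<And>x. f (h x) = g x"
proof -
  have h: "extends_along h v w" using compl by (simp add: is_completion_def)
  interpret w: valuation w using h by unfold_locales (simp add: extends_along_iff)
  interpret u: valuation u using g by unfold_locales (simp add: extends_along_iff)
  interpret h: field_embedding h using h by (simp add: extends_along_iff)
  interpret g: field_embedding g using g by (simp add: extends_along_iff)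
  have ex: "\<exists>l. val_tendsto u (\<lambda>n. g (s n)) l" if "val_tendsto w (\<lambda>n. h (s n)) y" for s y
  proof -
    have "val_Cauchy v s"
      using w.tendsto_imp_Cauchy[OF that] Cauchy_embedding_iff[OF h] by blast
    then show ?thesis
      using u Cauchy_embedding_iff[OF g] unfolding val_complete_def by blast
  qed
  have "\<exists>s l. val_tendsto w (\<lambda>n. h (s n)) y \<and> val_tendsto u (\<lambda>n. g (s n)) l" for y
    using compl ex unfolding is_completion_def by metis
  then obtain S f where S: "\<And>y. val_tendsto w (\<lambda>n. h (S y n)) y"
    and f: "\<And>y. val_tendsto u (\<lambda>n. g (S y n)) (f y)"
    by metis
  \<comment> \<open>Independence of the approximating sequence: two of them differ by a null
    sequence, and \<open>g\<close> keeps it null. Sums and products can then be approximated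
    termwise.\<close>
  have lim: "val_tendsto u (\<lambda>n. g (s n)) (f y)" if "val_tendsto w (\<lambda>n. h (s n)) y" for s y
  proof -
    have "val_tendsto w (\<lambda>n. h (s n - S y n)) (h 0)"
      using w.tendsto_diff[OF that S[of y]] by (simp add: h.diff h.zero)
    then have "val_tendsto u (\<lambda>n. g (s n - S y n)) (g 0)"
      by (simp only: tendsto_embedding_iff[OF h] tendsto_embedding_iff[OF g])
    from u.tendsto_add[OF this f[of y]] show ?thesis
      by (simp add: g.diff g.zero)
  qed
  have fh: "f (h x) = g x" for x
    using lim[OF w.tendsto_const, of x] u.tendsto_const u.tendsto_unique by blast
  have f_emb: "field_embedding f"
  proof
    fix x y
    show "f (x + y) = f x + f y"
      using lim[of "\<lambda>n. S x n + S y n" "x + y"] w.tendsto_add[OF S S, of x y]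
        u.tendsto_add[OF f f, of x y]
      by (simp add: h.add g.add u.tendsto_unique)
    show "f (x * y) = f x * f y"
      using lim[of "\<lambda>n. S x n * S y n" "x * y"] w.tendsto_mult[OF S S, of x y]
        u.tendsto_mult[OF f f, of x y]
      by (simp add: h.mult g.mult u.tendsto_unique)
    show "f 1 = 1"
      using fh[of 1] by (simp add: h.one g.one)
  qed
  have "u (f y) = w y" for y
  proof (cases "y = 0")
    case True
    then show ?thesis by (simp add: field_embedding.zero[OF f_emb] u.zero w.zero)
  next
    case False
    \<comment> \<open>By injectivity \<open>f y\<close> is nonzero as well, so the values on both
      sides are eventually constant and one common index compares them.\<close>
    then have "\<forall>\<^sub>F n in sequentially. w (h (S y n)) = w y \<and> u (g (S y n)) = u (f y)"
      using w.eventually_val_eq[OF S] u.eventually_val_eq[OF f]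
      by (simp add: field_embedding.eq_0_iff[OF f_emb] eventually_conj_iff)
    then obtain n where "w (h (S y n)) = w y" "u (g (S y n)) = u (f y)"
      by (auto simp: eventually_sequentially)
    moreover have "u (g (S y n)) = w (h (S y n))"
      using g h by (simp add: extends_along_iff)
    ultimately show ?thesis by simp
  qed
  then have "extends_along f w u"
    using f_emb u.is_valuation by (simp add: extends_along_iff)
  then show thesis using fh by (rule that)
qed

section \<open>Transcendence and evaluation of rational functions\<close>

text \<open>The list polynomials of \<open>ring.eval\<close> start with the leading coefficient,
  those of \<open>Poly\<close> with the constant term; hence the reversal.\<close>

lemma eval_type_ring: "ring.eval (type_ring :: 'a::field ring) p x = poly (Poly (rev p)) x"
proof -
  interpret R: field "type_ring :: 'a ring" by (rule field_from_type_algebra)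
  have pow: "x [^]\<^bsub>type_ring\<^esub> n = x ^ n" for n
    by (induction n) (simp_all add: ring_of_type_algebra_def)
  show ?thesis
  proof (induction p)
    case (Cons a p)
    then show ?case
      by (simp add: pow Poly_snoc poly_monom) (simp add: ring_of_type_algebra_def algebra_simps)
  next
    case Nil
    then show ?case
      by simp (simp add: ring_of_type_algebra_def)
  qed
qed

text \<open>Transcendence is defined as injectivity of evaluation on list polynomials over
  \<open>range e\<close>. These lists correspond bijectively to polynomials f over the source field,
  and by additivity injectivity amounts to a trivial kernel.\<close>

lemma transcendental_iff:
  fixes e :: "'a::field \<Rightarrow> 'b::field"
  assumes "field_embedding e"
  shows "ring.transcendental type_ring (range e) x \<longleftrightarrow>
    (\<forall>f. poly (map_poly e f) x = 0 \<longrightarrow> f = 0)"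
proof -
  interpret e: field_embedding e by fact
  interpret R: field "type_ring :: 'b ring" by (rule field_from_type_algebra)
  let ?C = "carrier (univ_poly (type_ring :: 'b ring) (range e))"
  have C: "p \<in> ?C \<longleftrightarrow> p = [] \<or> set p \<subseteq> range e \<and> hd p \<noteq> 0" for p
    by (simp add: univ_poly_def polynomial_def ring_of_type_algebra_def)
  have coeffs: "coeffs (map_poly e f) = map e (coeffs f)" for f
    by (simp add: coeffs_map_poly' e.eq_0_iff)
  have inj_e: "inj e"
    by (simp add: inj_def e.eq_iff)
  have mem: "rev (coeffs (map_poly e f)) \<in> ?C" for f
    by (cases "f = 0")
      (auto simp: C coeffs hd_rev last_map e.eq_0_iff last_coeffs_eq_coeff_degree)
  have surj: "\<exists>f. p = rev (coeffs (map_poly e f))" if "p \<in> ?C" for p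
  proof -
    have "set p \<subseteq> range e"
      using that by (auto simp: C)
    then obtain q where q: "p = map e q"
      by (metis ex_map_conv imageE subsetD)
    \<comment> \<open>The nonzero leading coefficient of p becomes the last entry after reversal, so
      \<open>Poly\<close> strips nothing and the list is recovered exactly.\<close>
    have "no_trailing (HOL.eq 0) (rev q)"
      using that e.zero by (cases q) (auto simp: C q no_trailing_unfold)
    then have "coeffs (Poly (rev q)) = rev q"
      by (metis coeffs_Poly strip_while_idem_iff)
    then have "coeffs (map_poly e (Poly (rev q))) = map e (rev q)"
      by (simp only: coeffs)
    then show ?thesis
      using q by (metis rev_map rev_rev_ident)
  qed
  have C_eq: "?C = range (\<lambda>f. rev (coeffs (map_poly e f)))"
    using mem surj by blast
  have "inj (\<lambda>f. rev (coeffs (map_poly e f)))"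
    by (simp add: inj_def coeffs inj_map_eq_map[OF inj_e] coeffs_eq_iff)
  then have "ring.transcendental type_ring (range e) x \<longleftrightarrow>
      inj (\<lambda>f. poly (map_poly e f) x)"
    unfolding R.transcendental_def C_eq
    by (subst comp_inj_on_iff) (simp_all add: eval_type_ring o_def)
  also have "\<dots> \<longleftrightarrow> (\<forall>f. poly (map_poly e f) x = 0 \<longrightarrow> f = 0)"
  proof
    show "inj (\<lambda>f. poly (map_poly e f) x) \<Longrightarrow> \<forall>f. poly (map_poly e f) x = 0 \<longrightarrow> f = 0"
      by (metis injD map_poly_0 poly_0)
    assume *: "\<forall>f. poly (map_poly e f) x = 0 \<longrightarrow> f = 0"
    show "inj (\<lambda>f. poly (map_poly e f) x)"
    proof (rule injI)
      fix f g
      assume "poly (map_poly e f) x = poly (map_poly e g) x"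
      then have "poly (map_poly e (f - g)) x = 0"
        using e.poly_add[of "f - g" g x] by simp
      with * show "f = g" by force
    qed
  qed
  finally show ?thesis .
qed

lemma padic_valuation_self:
  assumes "prime p"
  shows "padic_valuation p (of_nat p) = 1"
proof -
  have "quotient_of (of_nat p) = (int p, 1)"
    using quotient_of_int[of "int p"] by (simp add: Rat.of_int_def)
  moreover have "\<not> is_unit (int p)"
    using assms by auto
  ultimately show ?thesis
    using assms prime_gt_0_nat[OF assms]
    by (simp add: padic_valuation_def multiplicity_self)
qed

text \<open>Injectivity of \<open>ev\<close> means that no nonzero denominator vanishes at
  \<open>\<alpha>\<close>. Every rational function is thus defined there, and integrality is a
  condition on the pulled-back valuation alone.\<close>

lemma integral_at_eq:
  assumes ev: "field_embedding ev"
    and ev_poly: "\<And>f. ev (to_fract f) = poly (map_poly e f) \<alpha>"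
  shows "integral_at e vC \<alpha> = valuation_ring_of (\<lambda>x. vC (ev x))"
proof -
  interpret ev: field_embedding ev by fact
  have *: "poly (map_poly e g) \<alpha> \<noteq> 0 \<longleftrightarrow> g \<noteq> 0" for g
    by (simp add: ev.eq_0_iff flip: ev_poly)
  have "integral_at e vC \<alpha> = {Fract f g | f g. g \<noteq> 0 \<and> 0 \<le> vC (ev (Fract f g))}"
    unfolding integral_at_def * valuation_ring_of_def
    by (simp add: Fract_conv_to_fract ev.divide ev_poly)
  also have "\<dots> = valuation_ring_of (\<lambda>x. vC (ev x))"
    by (auto simp: valuation_ring_of_def) (metis Fract_cases)
  finally show ?thesis .
qed

text \<open>Horner's scheme: an embedding is known on all polynomials once it is known on the
  constants and on X.\<close>

lemma evaluation_if_embedding: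
  assumes ev: "field_embedding ev"
  shows "ev (to_fract f) = poly (map_poly (ev \<circ> const_fract) f) (ev (to_fract [:0, 1:]))"
proof (induction f)
  case 0
  then show ?case by (simp add: field_embedding.zero[OF ev])
next
  case (pCons a f)
  interpret ev: field_embedding ev by fact
  have "to_fract (pCons a f) = const_fract a + to_fract [:0, 1:] * to_fract f"
    by (simp add: const_fract_def flip: to_fract_add to_fract_mult)
  then show ?case
    by (simp add: ev.add ev.mult pCons map_poly_pCons const_fract_def ev.zero)
qed

section \<open>Embeddings of the completion and transcendental points\<close>

theorem proposition2p23:
  fixes p :: nat
    and v :: "'q::field \<Rightarrow> ereal" and i :: "rat \<Rightarrow> 'q"
    and vbar :: "'k::field \<Rightarrow> ereal" and j :: "'q \<Rightarrow> 'k"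
    and vC :: "'c::field \<Rightarrow> ereal" and k :: "'k \<Rightarrow> 'c"
    and W :: "'q poly fract set"
    and w :: "'q poly fract \<Rightarrow> ereal"
    and wL :: "'l::field \<Rightarrow> ereal" and h :: "'q poly fract \<Rightarrow> 'l"
  assumes p: "prime p"
    and Qp: "is_completion (padic_valuation p) v i"
    and Qp_bar: "algebraic_closure (type_ring :: 'k ring) (range j)"
    and v_bar: "extends_along j v vbar"
    and Cp: "is_completion vbar vC k"
    and W_extension: "is_extension_to_fract v W"
    and W_residually_algebraic: "residually_algebraic v W"
    and W_torsion: "is_torsion v W"
    and w: "is_valuation_for v W w"
    and completion: "is_completion w wL h"
  shows "iso_to_valued_subfield wL vC \<longleftrightarrow>
         (\<exists>\<alpha>. ring.transcendental (type_ring :: 'c ring) (range (k \<circ> j)) \<alpha> \<and>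
              W = integral_at (k \<circ> j) vC \<alpha>)"
proof -
  define e where "e = k \<circ> j"
  have i: "extends_along i (padic_valuation p) v"
    using Qp by (simp add: is_completion_def)
  have e: "extends_along e v vC"
    unfolding e_def using v_bar Cp extends_along_comp by (auto simp: is_completion_def)
  then interpret e: field_embedding e by (simp add: extends_along_iff)
  have const: "extends_along const_fract v w" and W: "valuation_ring_of w = W"
    using w by (simp_all add: is_valuation_for_def)
  have h: "extends_along h w wL"
    using completion by (simp add: is_completion_def)
  show ?thesis
    unfolding e_def[symmetric]
  proof
    assume "iso_to_valued_subfield wL vC"
    then obtain f where f: "extends_along f wL vC"
      using e by (auto simp: iso_to_valued_subfield_iff extends_along_iff)
    define ev where "ev = f \<circ> h"
    have ev: "extends_along ev w vC"
      unfolding ev_def using h f by (rule extends_along_comp)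
    then interpret ev: field_embedding ev by (simp add: extends_along_iff)
    have evc: "extends_along (ev \<circ> const_fract) v vC"
      using const ev by (rule extends_along_comp)
    \<comment> \<open>Both sides are embeddings of the rationals. Density then forces
      \<open>ev\<close> to be \<open>e\<close> on constants, so the coefficients in the evaluation
      formula are mapped by the prescribed embedding.\<close>
    have "ev \<circ> const_fract \<circ> i = e \<circ> i"
      using field_embedding_rat_unique extends_along_comp[OF i evc] extends_along_comp[OF i e]
      by (auto simp: extends_along_iff)
    with completion_embedding_unique[OF Qp evc e] have "ev \<circ> const_fract = e" by blast
    then have ev_poly: "ev (to_fract g) = poly (map_poly e g) (ev (to_fract [:0, 1:]))" for g
      using evaluation_if_embedding[OF ev.field_embedding_axioms, of g] by simp
    have "(\<lambda>x. vC (ev x)) = w"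
      using ev by (simp add: extends_along_iff)
    then have "W = integral_at e vC (ev (to_fract [:0, 1:]))"
      using integral_at_eq[OF ev.field_embedding_axioms ev_poly] W
      by simp
    moreover have "ring.transcendental type_ring (range e) (ev (to_fract [:0, 1:]))"
      unfolding transcendental_iff[OF e.field_embedding_axioms] ev_poly[symmetric] ev.eq_0_iff
      by simp
    ultimately show "\<exists>\<alpha>. ring.transcendental type_ring (range e) \<alpha> \<and> W = integral_at e vC \<alpha>"
      by blast
  next
    assume "\<exists>\<alpha>. ring.transcendental type_ring (range e) \<alpha> \<and> W = integral_at e vC \<alpha>"
    then obtain \<alpha> where \<alpha>: "\<And>f. poly (map_poly e f) \<alpha> = 0 \<Longrightarrow> f = 0"
      and W_\<alpha>: "W = integral_at e vC \<alpha>"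
      using transcendental_iff[OF e.field_embedding_axioms] by blast
    have "poly (map_poly e 1) \<alpha> = 1"
      by (simp add: map_poly_1' e.one)
    then obtain ev where ev: "field_embedding ev"
      and ev_poly: "\<And>f. ev (to_fract f) = poly (map_poly e f) \<alpha>"
      using extend_to_fract[of "\<lambda>f. poly (map_poly e f) \<alpha>", OF e.poly_add e.poly_mult _ \<alpha>]
      by blast
    define \<pi> where "\<pi> = const_fract (i (of_nat p))"
    have vp: "v (i (of_nat p)) = 1"
      using i padic_valuation_self[OF p] by (simp add: extends_along_iff)
    have "w = (\<lambda>x. vC (ev x))"
    \<comment> \<open>The prime p, seen as a constant function, sets the scale: both valuations
      restrict to \<open>v\<close> on constants and hence give it the value 1.\<close>
    proof (rule valuation_eqI[where \<pi> = \<pi>])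
      show "is_valuation w" using const by (simp add: extends_along_iff)
      show "is_valuation (\<lambda>x. vC (ev x))"
        using ev e by (simp add: is_valuation_pullback extends_along_iff)
      show "valuation_ring_of w = valuation_ring_of (\<lambda>x. vC (ev x))"
        using W W_\<alpha> integral_at_eq[OF ev ev_poly] by simp
      have w\<pi>: "w \<pi> = 1" using const vp by (simp add: \<pi>_def extends_along_iff)
      have "ev \<pi> = e (i (of_nat p))"
        by (simp add: \<pi>_def const_fract_def ev_poly e.poly_pCons)
      then show "w \<pi> = vC (ev \<pi>)" using w\<pi> vp e by (simp add: extends_along_iff)
      show "0 < w \<pi>" by (simp add: w\<pi>)
      have "w 0 = \<infinity>" using \<open>is_valuation w\<close> by (simp add: valuation.zero valuation_def)
      then show "\<pi> \<noteq> 0" using w\<pi> by auto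
    qed
    then have "\<forall>x. vC (ev x) = w x" by simp
    with ev e have "extends_along ev w vC"
      by (simp add: extends_along_iff)
    \<comment> \<open>Completeness of the target lets the isometric evaluation extend from rational
      functions to their completion.\<close>
    moreover have "val_complete vC" using Cp by (simp add: is_completion_def)
    ultimately obtain f where "extends_along f wL vC"
      using completion_extend[OF completion] by blast
    then show "iso_to_valued_subfield wL vC"
      by (auto simp: iso_to_valued_subfield_iff extends_along_iff)
  qed
qed

end
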